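(* Let $E$ be an analytic equivalence relation on $(2^{\mathbb{N}})^{\mathbb{N}}$ with $E_0^{\mathbb{N}}\subseteq E$. Then either $E_0^{\mathbb{N}}\le_B E$, or there is $k\in\mathbb{N}$ such that $E$ extends $E_0^k$ on a comeager set, i.e. there is a comeager $C\subseteq(2^{\mathbb{N}})^{\mathbb{N}}$ such that for all $x,y\in C$, if $x\restriction k\mathrel{E_0^k}y\restriction k$ then $x\mathrel{E}y$.
   Context: $E_0$ is eventual equality on $2^{\mathbb{N}}$. $E_0^{\mathbb{N}}$ is the equivalence relation on $(2^{\mathbb{N}})^{\mathbb{N}}$ given by $x\mathrel{E_0^{\mathbb{N}}}y$ iff $x(n)\mathrel{E_0}y(n)$ for all $n$; $E_0^k$ on $(2^{\mathbb{N}})^k$ is defined likewise for $n<k$. $E_0^{\mathbb{N}}\le_B E$ means there is a Borel map $f$ with $x\mathrel{E_0^{\mathbb{N}}}y\iff f(x)\mathrel{E}f(y)$. $(2^{\mathbb{N}})^{\mathbb{N}}$ has the product topology. *)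

theory Defs
  imports "HOL-Analysis.Analysis"
begin

text \<open>\<open>2\<^sup>\<nat>\<close> is \<^typ>\<open>nat \<Rightarrow> bool\<close>: the library instances give \<^typ>\<open>bool\<close> the discrete topology
  and function types the product topology. The same instances make \<^typ>\<open>nat \<Rightarrow> nat\<close> the Baire
  space and put the product topology on \<open>(2\<^sup>\<nat>)\<^sup>\<nat>\<close>.\<close>

type_synonym cantor = "nat \<Rightarrow> bool"

definition nowhere_dense :: "'a::topological_space set \<Rightarrow> bool" where
  "nowhere_dense A \<longleftrightarrow> interior (closure A) = {}"

definition meager :: "'a::topological_space set \<Rightarrow> bool" where
  "meager A \<longleftrightarrow> (\<exists>N :: nat \<Rightarrow> 'a set. (\<forall>n. nowhere_dense (N n)) \<and> A = (\<Union>n. N n))"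

definition comeager :: "'a::topological_space set \<Rightarrow> bool" where
  "comeager A \<longleftrightarrow> meager (- A)"

text \<open>Analytic subsets of a Polish space: the continuous images of the Baire space,
  together with the empty set.\<close>

definition analytic_set :: "'a::topological_space set \<Rightarrow> bool" where
  "analytic_set A \<longleftrightarrow>
     A = {} \<or> (\<exists>f :: (nat \<Rightarrow> nat) \<Rightarrow> 'a. continuous_on UNIV f \<and> range f = A)"

definition borel_reducible ::
    "('a::topological_space \<times> 'a) set \<Rightarrow> ('b::topological_space \<times> 'b) set \<Rightarrow> bool"
    (infix "\<le>\<^sub>B" 50) where
  "R \<le>\<^sub>B S \<longleftrightarrow> (\<exists>f \<in> borel_measurable borel. \<forall>x y. (x, y) \<in> R \<longleftrightarrow> (f x, f y) \<in> S)"

definition E0 :: "(cantor \<times> cantor) set" where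
  "E0 = {(x, y). \<forall>\<^sub>F i in sequentially. x i = y i}"

definition E0_omega :: "((nat \<Rightarrow> cantor) \<times> (nat \<Rightarrow> cantor)) set" where
  "E0_omega = {(x, y). \<forall>n. (x n, y n) \<in> E0}"

text \<open>\<open>(2\<^sup>\<nat>)\<^sup>k\<close> is the extensional function space on \<open>{..<k}\<close>, so that \<open>x \<restriction> k\<close> is
  \<open>restrict x {..<k}\<close>.\<close>

definition E0_fin :: "nat \<Rightarrow> ((nat \<Rightarrow> cantor) \<times> (nat \<Rightarrow> cantor)) set" where
  "E0_fin k = {(x, y). x \<in> {..<k} \<rightarrow>\<^sub>E UNIV \<and> y \<in> {..<k} \<rightarrow>\<^sub>E UNIV \<and> (\<forall>n<k. (x n, y n) \<in> E0)}"

end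

theory Submission
  imports Defs
begin

text \<open>Let \<open>A\<^sub>k\<close> be the set of pairs \<open>(x, y)\<close> such that \<open>x\<close> is \<open>E\<close>-related to the sequence that
  agrees with \<open>x\<close> below \<open>k\<close> and with \<open>y\<close> from \<open>k\<close> on.

  If some \<open>A\<^sub>k\<close> is nonmeager then, being the preimage of an analytic set, it is comeager in a
  nonempty open set; since \<open>A\<^sub>k\<close> is invariant under changing finitely many bits, it is comeager. By
  Kuratowski-Ulam, comeagerly many \<open>x\<close> have a comeager section, and two such \<open>x\<close>, \<open>x'\<close> whose first \<open>k\<close>
  coordinates are \<open>E\<^sub>0\<close>-related are \<open>E\<close>-related via any \<open>y\<close> common to both sections.

  If every \<open>A\<^sub>k\<close> is meager, choose pairwise disjoint finite sets \<open>F\<^sub>k\<^sub>i\<close> of bit positions and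
  patterns \<open>v\<^sub>k\<^sub>i\<close>, \<open>w\<^sub>k\<^sub>i\<close> on them such that a pair matching \<open>(v\<^sub>k\<^sub>i, w\<^sub>k\<^sub>i)\<close> for infinitely many
  \<open>i\<close> lies outside \<open>A\<^sub>k\<close>. The reduction \<open>f\<close> writes \<open>v\<^sub>k\<^sub>i\<close> on the part of \<open>F\<^sub>k\<^sub>i\<close> below coordinate
  \<open>k\<close>, and either \<open>v\<^sub>k\<^sub>i\<close> or \<open>w\<^sub>k\<^sub>i\<close> on the rest according to the bit \<open>x k i\<close>. If \<open>k\<close> is least with
  \<open>x k\<close>, \<open>y k\<close> not \<open>E\<^sub>0\<close>-related, then \<open>f x\<close> and \<open>f y\<close> are \<open>E\<^sub>0\<close>-related below \<open>k\<close> and match the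
  patterns infinitely often from \<open>k\<close> on, in one order or the other.\<close>

section \<open>Meager sets\<close>

text \<open>Sequence spaces over \<open>bool\<close> thereby have a countable base, as the Lindelof
  and Kuratowski-Ulam arguments require.\<close>

instance bool :: second_countable_topology
proof
  have "open = generate_topology (UNIV :: bool set set)"
    by (auto simp: fun_eq_iff open_discrete intro: generate_topology.Basis)
  then show "\<exists>B::bool set set. countable B \<and> open = generate_topology B"
    by blast
qed

lemma open_fun_finite:
  assumes "open (U :: ('i \<Rightarrow> 'a::topological_space) set)" "x \<in> U"
  shows "\<exists>I X. finite I \<and> (\<forall>i. open (X i) \<and> x i \<in> X i) \<and> (\<forall>y. (\<forall>i\<in>I. y i \<in> X i) \<longrightarrow> y \<in> U)"
proof -
  have "openin (product_topology (\<lambda>_. euclidean) UNIV) U"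
    using assms(1) by (simp add: open_fun_def)
  from product_topology_open_contains_basis[OF this assms(2)]
  obtain X where X: "x \<in> (\<Pi>\<^sub>E i\<in>UNIV. X i)" "\<forall>i. open (X i)" "finite {i. X i \<noteq> UNIV}"
    "(\<Pi>\<^sub>E i\<in>UNIV. X i) \<subseteq> U"
    by (simp only: open_openin[symmetric] topspace_euclidean) metis
  have "y \<in> U" if "\<forall>i\<in>{i. X i \<noteq> UNIV}. y i \<in> X i" for y
  proof -
    from that have "y \<in> (\<Pi>\<^sub>E i\<in>UNIV. X i)" by (auto simp: PiE_iff)
    with X(4) show "y \<in> U" by blast
  qed
  moreover have "\<forall>i. open (X i) \<and> x i \<in> X i" using X(1,2) by (auto simp: PiE_iff)
  ultimately show ?thesis using X(3) by blast
qed

lemma open_fun_discrete_finite: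
  assumes "open (U :: ('i \<Rightarrow> 'a::discrete_topology) set)" "x \<in> U"
  shows "\<exists>I. finite I \<and> (\<forall>y. (\<forall>i\<in>I. y i = x i) \<longrightarrow> y \<in> U)"
  using open_fun_finite[OF assms] by metis

lemma nowhere_dense_subset: "nowhere_dense B \<Longrightarrow> A \<subseteq> B \<Longrightarrow> nowhere_dense A"
  unfolding nowhere_dense_def by (metis closure_mono interior_mono subset_empty)

lemma nowhere_dense_imp_meager: "nowhere_dense A \<Longrightarrow> meager A"
  unfolding meager_def by (intro exI[of _ "\<lambda>_. A"]) auto

lemma meager_subset:
  assumes "meager B" "A \<subseteq> B"
  shows "meager A"
proof -
  obtain N where N: "\<And>n::nat. nowhere_dense (N n)" "B = (\<Union>n. N n)"
    using assms(1) by (auto simp: meager_def)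
  have "nowhere_dense (N n \<inter> A)" for n
    using N(1) by (rule nowhere_dense_subset) auto
  moreover have "A = (\<Union>n. N n \<inter> A)" using N(2) assms(2) by auto
  ultimately show ?thesis unfolding meager_def
    by (intro exI[of _ "\<lambda>n. N n \<inter> A"] conjI allI)
qed

lemma meager_empty: "meager {}"
  by (rule nowhere_dense_imp_meager) (simp add: nowhere_dense_def)

lemma meager_UN_nat:
  fixes A :: "nat \<Rightarrow> 'a::topological_space set"
  assumes "\<And>n. meager (A n)"
  shows "meager (\<Union>n. A n)"
proof -
  obtain N where N: "\<And>n m. nowhere_dense (N n m)" "\<And>n. A n = (\<Union>m::nat. N n m)"
    using assms unfolding meager_def by metis
  have "(\<Union>n. A n) = (\<Union>t. N (fst (prod_decode t)) (snd (prod_decode t)))"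
  proof safe
    fix x n assume "x \<in> A n"
    then obtain m where "x \<in> N n m" using N(2) by auto
    then show "x \<in> (\<Union>t. N (fst (prod_decode t)) (snd (prod_decode t)))"
      by (intro UN_I[of "prod_encode (n, m)"]) auto
  qed (use N(2) in auto)
  with N(1) show ?thesis unfolding meager_def
    by (intro exI[of _ "\<lambda>t. N (fst (prod_decode t)) (snd (prod_decode t))"] conjI allI)
qed

lemma meager_UN:
  assumes "countable I" "\<And>i. i \<in> I \<Longrightarrow> meager (A i)"
  shows "meager (\<Union>i\<in>I. A i)"
proof (cases "I = {}")
  case False
  then have "(\<Union>i\<in>I. A i) = (\<Union>n. A (from_nat_into I n))"
    by (metis assms(1) range_from_nat_into image_image)
  with False assms(2) show ?thesis
    by (simp add: meager_UN_nat from_nat_into)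
qed (simp add: meager_empty)

lemma meager_Un: "meager A \<Longrightarrow> meager B \<Longrightarrow> meager (A \<union> B)"
  using meager_UN[of "{A, B}" id] by auto

lemma nowhere_dense_closed_diff_interior:
  assumes "closed Q"
  shows "nowhere_dense (Q - interior Q)"
proof -
  have "closed (Q - interior Q)" using assms by (simp add: closed_Diff)
  moreover have "interior (Q - interior Q) = {}"
    using interior_subset interior_maximal[of "interior (Q - interior Q)" Q]
    by (metis DiffD2 Diff_subset equals0I interior_mono open_interior subsetD)
  ultimately show ?thesis by (simp add: nowhere_dense_def)
qed

lemma nowhere_dense_closure_diff_open:
  assumes "open G"
  shows "nowhere_dense (closure G - G)"
proof -
  have "closed (closure G - G)" using assms by (simp add: closed_Diff)
  moreover have "interior (closure G - G) = {}"
  proof (rule ccontr)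
    assume "interior (closure G - G) \<noteq> {}"
    then obtain x where "x \<in> interior (closure G - G)" by auto
    moreover from this have "x \<in> closure G" using interior_subset by blast
    ultimately have "interior (closure G - G) \<inter> G \<noteq> {}"
      by (metis Int_commute disjoint_iff open_Int_closure_eq_empty open_interior)
    then show False using interior_subset by blast
  qed
  ultimately show ?thesis by (simp add: nowhere_dense_def)
qed

text \<open>A continuous involution is its own inverse, hence a homeomorphism. The involutions in
  question are the bit flips \<open>flip S\<close>, taken coordinatewise on pairs.\<close>

lemma nowhere_dense_vimage_involution:
  assumes f: "continuous_on UNIV f" "\<And>x. f (f x) = x" and "nowhere_dense B"
  shows "nowhere_dense (f -` B)"
proof -
  have "closure (f -` B) \<subseteq> f -` closure B"
    using f(1) by (intro closure_minimal vimage_mono closure_subset closed_vimage) auto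
  then have "f -` interior (closure (f -` B)) \<subseteq> closure B"
    using interior_subset f(2) by fastforce
  moreover have "open (f -` interior (closure (f -` B)))"
    by (intro open_vimage f open_interior)
  ultimately have "f -` interior (closure (f -` B)) \<subseteq> {}"
    using assms(3) interior_maximal unfolding nowhere_dense_def by metis
  with f(2) show ?thesis unfolding nowhere_dense_def
    by (metis equals0I subset_empty vimage_eq empty_iff)
qed

lemma meager_vimage_involution:
  assumes "continuous_on UNIV f" "\<And>x. f (f x) = x" "meager A"
  shows "meager (f -` A)"
proof -
  obtain N where "\<And>n::nat. nowhere_dense (N n)" "A = (\<Union>n. N n)"
    using assms(3) by (auto simp: meager_def)
  with nowhere_dense_vimage_involution[OF assms(1,2)] show ?thesis unfolding meager_def
    by (intro exI[of _ "\<lambda>n. f -` N n"]) auto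
qed

lemma nowhere_dense_UN_finite:
  assumes "finite I" "\<And>i. i \<in> I \<Longrightarrow> nowhere_dense (A i)"
  shows "nowhere_dense (\<Union>i\<in>I. A i)"
  using assms
proof (induction I)
  case (insert i I)
  then have "interior (closure (A i) \<union> closure (\<Union>j\<in>I. A j)) = {}"
    by (subst interior_closed_Un_empty_interior) (auto simp: nowhere_dense_def)
  then show ?case by (simp add: nowhere_dense_def)
qed (simp add: nowhere_dense_def)

text \<open>If a section of the closed set \<open>closure (N n)\<close> has interior, it contains a
  nonempty basic open \<open>b\<close>. The points \<open>x\<close> for which this happens form the
  closed set \<open>P n b\<close>. It has empty interior, since otherwise an open box would lie in
  \<open>closure (N n)\<close>. There are only countably many \<open>P n b\<close>.\<close>

lemma Kuratowski_Ulam: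
  fixes A :: "('a::topological_space \<times> 'b::second_countable_topology) set"
  assumes "meager A"
  shows "meager {x. \<not> meager {y. (x, y) \<in> A}}"
proof -
  obtain N where N: "\<And>n::nat. nowhere_dense (N n)" "A = (\<Union>n. N n)"
    using assms by (auto simp: meager_def)
  obtain B :: "'b set set" where B: "countable B" "topological_basis B"
    using ex_countable_basis by blast
  define P where "P n b = {x. \<forall>y\<in>b. (x, y) \<in> closure (N n)}" for n b
  have "nowhere_dense (P n b)" if "b \<in> B - {{}}" for n b
  proof -
    have "open b" using that B(2) topological_basis_open by blast
    then have "open (fst ` (- closure (N n) \<inter> UNIV \<times> b))"
      by (intro open_image_fst open_Int open_Times) auto
    moreover have "- P n b = fst ` (- closure (N n) \<inter> UNIV \<times> b)"
      by (force simp: P_def)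
    ultimately have "closed (P n b)" by (simp add: closed_def)
    moreover have "interior (P n b) = {}"
    proof -
      have "open (interior (P n b) \<times> b)" using \<open>open b\<close> by (intro open_Times) auto
      moreover have "interior (P n b) \<times> b \<subseteq> closure (N n)"
        using interior_subset[of "P n b"] by (auto simp: P_def)
      ultimately have "interior (P n b) \<times> b \<subseteq> interior (closure (N n))"
        by (intro interior_maximal)
      with N(1)[of n] that show ?thesis by (auto simp: nowhere_dense_def)
    qed
    ultimately show ?thesis by (simp add: nowhere_dense_def)
  qed
  then have "meager (\<Union>(n, b)\<in>UNIV \<times> (B - {{}}). P n b)"
    using B(1) by (intro meager_UN) (auto intro: nowhere_dense_imp_meager)
  then show ?thesis
  proof (rule meager_subset, intro subsetI)
    fix x assume x: "x \<in> {x. \<not> meager {y. (x, y) \<in> A}}"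
    show "x \<in> (\<Union>(n, b)\<in>UNIV \<times> (B - {{}}). P n b)"
    proof (rule ccontr)
      assume *: "x \<notin> (\<Union>(n, b)\<in>UNIV \<times> (B - {{}}). P n b)"
      have "nowhere_dense {y. (x, y) \<in> N n}" for n
      proof (rule nowhere_dense_subset)
        show "{y. (x, y) \<in> N n} \<subseteq> Pair x -` closure (N n)"
          using closure_subset[of "N n"] by auto
        have "closed (Pair x -` closure (N n))"
          by (intro closed_vimage continuous_intros) auto
        moreover have "interior (Pair x -` closure (N n)) = {}"
        proof (rule ccontr)
          assume "interior (Pair x -` closure (N n)) \<noteq> {}"
          then obtain y where "y \<in> interior (Pair x -` closure (N n))" by auto
          then obtain b where b: "b \<in> B" "y \<in> b" "b \<subseteq> interior (Pair x -` closure (N n))"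
            using B(2) topological_basisE[OF B(2) open_interior] by metis
          have "x \<in> P n b" using subset_trans[OF b(3) interior_subset] by (auto simp: P_def)
          with * b show False by auto
        qed
        ultimately show "nowhere_dense (Pair x -` closure (N n))"
          by (simp add: nowhere_dense_def)
      qed
      then have "meager (\<Union>n. {y. (x, y) \<in> N n})"
        by (intro meager_UN_nat nowhere_dense_imp_meager)
      moreover have "{y. (x, y) \<in> A} = (\<Union>n. {y. (x, y) \<in> N n})" using N(2) by auto
      ultimately show False using x by simp
    qed
  qed
qed

lemma not_meager_UNIV:
  assumes "compact_space (euclidean :: 'a::topological_space topology)"
    and "Hausdorff_space (euclidean :: 'a topology)"
  shows "\<not> meager (UNIV :: 'a set)"
proof
  assume "meager (UNIV :: 'a set)"
  then obtain N where N: "\<And>n::nat. nowhere_dense (N n)" "(UNIV :: 'a set) = (\<Union>n. N n)"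
    by (auto simp: meager_def)
  have "(euclidean :: 'a topology) interior_of \<Union> (range (\<lambda>n. closure (N n))) = {}"
  proof (rule Baire_category_alt)
    show "completely_metrizable_space (euclidean :: 'a topology) \<or>
        locally_compact_space (euclidean :: 'a topology) \<and> regular_space (euclidean :: 'a topology)"
      using assms compact_imp_locally_compact_space compact_Hausdorff_imp_regular_space by blast
  qed (use N(1) in \<open>auto simp: nowhere_dense_def\<close>)
  moreover have "\<Union> (range (\<lambda>n. closure (N n))) = UNIV"
    using N(2) closure_subset by blast
  ultimately show False by simp
qed

text \<open>Take the interior of the complement of all open sets in which \<open>A\<close> is
  meager. By Lindelof, countably many of these sets have the same union, so \<open>A\<close> is
  meager on it; the boundary that is lost is nowhere dense.\<close>

lemma meager_outside_locally_nonmeager: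
  fixes A :: "'a::second_countable_topology set"
  obtains O' where "open O'" "meager (A - O')"
    "\<And>U. open U \<Longrightarrow> U \<inter> O' \<noteq> {} \<Longrightarrow> \<not> meager (A \<inter> U)"
proof -
  define \<U> where "\<U> = {U. open U \<and> meager (A \<inter> U)}"
  define Q where "Q = - \<Union>\<U>"
  have "closed Q" unfolding Q_def \<U>_def by (auto intro: open_Union)
  obtain \<V> where \<V>: "\<V> \<subseteq> \<U>" "countable \<V>" "\<Union>\<V> = \<Union>\<U>"
    by (rule Lindelof[of \<U>]) (auto simp: \<U>_def)
  have "meager (\<Union>V\<in>\<V>. A \<inter> V)"
    using \<V> by (intro meager_UN) (auto simp: \<U>_def)
  moreover have "A - Q = (\<Union>V\<in>\<V>. A \<inter> V)" using \<V> by (auto simp: Q_def)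
  ultimately have "meager (A - Q)" by simp
  then have "meager ((A - Q) \<union> (Q - interior Q))"
    using nowhere_dense_closed_diff_interior[OF \<open>closed Q\<close>]
    by (rule meager_Un[OF _ nowhere_dense_imp_meager])
  then have "meager (A - interior Q)" by (rule meager_subset) auto
  moreover have "\<not> meager (A \<inter> U)" if "open U" "U \<inter> interior Q \<noteq> {}" for U
  proof
    assume "meager (A \<inter> U)"
    with that(1) have "U \<in> \<U>" by (simp add: \<U>_def)
    with that(2) show False using interior_subset[of Q] by (auto simp: Q_def)
  qed
  ultimately show thesis using that by blast
qed

section \<open>Analytic sets and category\<close>

text \<open>The Souslin operation: \<open>A s\<close> is the part of the preimage coming from branches through \<open>s\<close>, and
  \<open>W s\<close> the open set in which \<open>A s\<close> is everywhere nonmeager. Off the meager set where \<open>W s\<close> fails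
  to split into the \<open>W (s @ [n])\<close>, a point of \<open>W []\<close> can be followed along a whole branch.\<close>

lemma vimage_analytic_comeager_in_open:
  fixes h :: "'a::second_countable_topology \<Rightarrow> 'b::topological_space"
  assumes "Hausdorff_space (euclidean :: 'b topology)"
    and h: "continuous_on UNIV h" and "analytic_set E" and nonmeager: "\<not> meager (h -` E)"
  obtains V where "open V" "V \<noteq> {}" "meager (V - h -` E)"
proof -
  have "E \<noteq> {}" using nonmeager meager_empty by auto
  then obtain f :: "(nat \<Rightarrow> nat) \<Rightarrow> 'b" where f: "continuous_on UNIV f" "range f = E"
    using assms(3) by (auto simp: analytic_set_def)
  define A where "A s = h -` f ` {\<alpha>. \<forall>i<length s. \<alpha> i = s ! i}" for s
  have A_Nil: "A [] = h -` E" using f(2) by (simp add: A_def)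
  have A_split: "A s \<subseteq> (\<Union>n. A (s @ [n]))" for s
  proof
    fix x assume "x \<in> A s"
    then obtain \<alpha> where \<alpha>: "h x = f \<alpha>" "\<forall>i<length s. \<alpha> i = s ! i" by (auto simp: A_def)
    then have "x \<in> A (s @ [\<alpha> (length s)])"
      by (auto simp: A_def nth_append less_Suc_eq intro!: image_eqI[of _ _ \<alpha>])
    then show "x \<in> (\<Union>n. A (s @ [n]))" by blast
  qed
  have "\<exists>W. open W \<and> meager (A s - W) \<and> (\<forall>U. open U \<longrightarrow> U \<inter> W \<noteq> {} \<longrightarrow> \<not> meager (A s \<inter> U))" for s
    by (rule meager_outside_locally_nonmeager[of "A s"]) blast
  then obtain W where W: "\<And>s. open (W s)" "\<And>s. meager (A s - W s)"
    "\<And>s U. open U \<Longrightarrow> U \<inter> W s \<noteq> {} \<Longrightarrow> \<not> meager (A s \<inter> U)" by metis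
  define G where "G s = (\<Union>n. W (s @ [n]))" for s
  have G: "open (G s)" for s using W(1) by (auto simp: G_def)
  \<comment> \<open>Otherwise \<open>- closure (G s)\<close> is an open set meeting
    \<open>W s\<close>, yet the part of \<open>A s\<close> in it is covered by the meager remainders
    \<open>A (s @ [n]) - W (s @ [n])\<close>.\<close>
  have "W s \<subseteq> closure (G s)" for s
  proof (rule ccontr)
    assume "\<not> W s \<subseteq> closure (G s)"
    then have "\<not> meager (A s \<inter> - closure (G s))" by (intro W(3)) auto
    moreover have "A s \<inter> - closure (G s) \<subseteq> (\<Union>n. A (s @ [n]) - W (s @ [n]))"
    proof
      fix x assume x: "x \<in> A s \<inter> - closure (G s)"
      then obtain n where n: "x \<in> A (s @ [n])" using A_split[of s] by auto
      have "x \<notin> W (s @ [n])" using x closure_subset[of "G s"] unfolding G_def by blast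
      with n show "x \<in> (\<Union>n. A (s @ [n]) - W (s @ [n]))" by blast
    qed
    moreover have "meager (\<Union>n. A (s @ [n]) - W (s @ [n]))"
      by (intro meager_UN_nat W(2))
    ultimately show False using meager_subset by metis
  qed
  then have "meager (W s - G s)" for s
    by (intro nowhere_dense_imp_meager
        nowhere_dense_subset[OF nowhere_dense_closure_diff_open[OF G]]) auto
  then have "meager (\<Union>s. W s - G s)" by (intro meager_UN) auto
  moreover have "W [] - h -` E \<subseteq> (\<Union>s. W s - G s)"
  proof (rule ccontr)
    assume "\<not> W [] - h -` E \<subseteq> (\<Union>s. W s - G s)"
    then obtain x where x: "x \<in> W []" "h x \<notin> E" "x \<notin> (\<Union>s. W s - G s)" by blast
    have W_G: "x \<in> G s" if "x \<in> W s" for s using x(3) that by blast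
    have "\<exists>t. \<forall>n. (x \<in> W (t n) \<and> length (t n) = n) \<and> (\<exists>m. t (Suc n) = t n @ [m])"
    proof (rule dependent_nat_choice)
      show "\<exists>s. x \<in> W s \<and> length s = 0" using x(1) by auto
      fix s n assume "x \<in> W s \<and> length s = n"
      then show "\<exists>s'. (x \<in> W s' \<and> length s' = Suc n) \<and> (\<exists>m. s' = s @ [m])"
        using W_G[of s] by (auto simp: G_def)
    qed
    then obtain t where t: "\<And>n. x \<in> W (t n)" "\<And>n. length (t n) = n"
      "\<And>n. \<exists>m. t (Suc n) = t n @ [m]" by blast
    define \<alpha> where "\<alpha> n = t (Suc n) ! n" for n
    have t_nth: "t n ! i = \<alpha> i" if "i < n" for i n
      using that
    proof (induction n)
      case (Suc n)
      obtain m where "t (Suc n) = t n @ [m]" using t(3) by blast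
      with Suc t(2)[of n] show ?case
        by (cases "i = n") (auto simp: nth_append \<alpha>_def)
    qed simp
    have "h x \<noteq> f \<alpha>" using x(2) f(2) by auto
    then obtain U V where UV: "open U" "open V" "h x \<in> U" "f \<alpha> \<in> V" "U \<inter> V = {}"
      using assms(1) unfolding Hausdorff_space_def disjnt_def by (metis open_openin UNIV_I topspace_euclidean)
    have "open (f -` V)" using UV(2) f(1) by (simp add: open_vimage)
    moreover have "\<alpha> \<in> f -` V" using UV(4) by simp
    ultimately obtain I where I: "finite I" "\<forall>\<beta>. (\<forall>i\<in>I. \<beta> i = \<alpha> i) \<longrightarrow> \<beta> \<in> f -` V"
      using open_fun_discrete_finite by metis
    obtain n where "I \<subseteq> {..<n}" using I(1) by (auto dest: finite_nat_iff_bounded[THEN iffD1])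
    with I(2) have n: "\<beta> \<in> f -` V" if "\<forall>i<n. \<beta> i = \<alpha> i" for \<beta>
      using that by blast
    have "open (h -` U)" using UV(1) h by (simp add: open_vimage)
    then have "\<not> meager (A (t n) \<inter> h -` U)"
      using t(1) UV(3) by (intro W(3)) auto
    moreover have "A (t n) \<inter> h -` U = {}"
      using n UV(5) t_nth[of _ n] by (fastforce simp: A_def t(2))
    ultimately show False by (simp add: meager_empty)
  qed
  ultimately have "meager (W [] - h -` E)" by (rule meager_subset)
  moreover have "W [] \<noteq> {}" using W(2)[of "[]"] nonmeager by (auto simp: A_Nil)
  ultimately show thesis using that W(1) by blast
qed

section \<open>The space \<open>(2\<^sup>\<nat>)\<^sup>\<nat>\<close>\<close>

lemma Hausdorff_bool: "Hausdorff_space (euclidean :: bool topology)"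
  unfolding Hausdorff_space_def disjnt_def
  by (metis Int_empty_right Int_insert_right_if0 UNIV_I empty_iff insertE insertI1 open_discrete open_openin)

lemma Hausdorff_fun:
  assumes "Hausdorff_space (euclidean :: 'a::topological_space topology)"
  shows "Hausdorff_space (euclidean :: ('i \<Rightarrow> 'a) topology)"
  unfolding euclidean_product_topology[symmetric] Hausdorff_space_product_topology
  using assms by simp

lemma compact_fun:
  assumes "compact_space (euclidean :: 'a::topological_space topology)"
  shows "compact_space (euclidean :: ('i \<Rightarrow> 'a) topology)"
  unfolding euclidean_product_topology[symmetric] compact_space_product_topology
  using assms by simp

lemma not_meager_UNIV_cantor_sequence: "\<not> meager (UNIV :: (nat \<Rightarrow> cantor) set)"
  by (intro not_meager_UNIV Hausdorff_fun compact_fun Hausdorff_bool)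
    (simp add: compact_space_def finite_imp_compact)

lemma continuous_on_bool_coordinate:
  "continuous_on UNIV (\<lambda>x :: nat \<Rightarrow> cantor. (g :: bool \<Rightarrow> bool) (x k i))"
proof -
  have "continuous_on UNIV (\<lambda>x :: nat \<Rightarrow> cantor. x k i)"
    by (rule continuous_on_product_then_coordinatewise[OF continuous_on_product_coordinates])
  moreover have "continuous_on UNIV g"
    by (simp add: continuous_on_open_vimage[OF open_UNIV] open_discrete)
  ultimately show ?thesis
    using continuous_on_compose2[of UNIV g UNIV "\<lambda>x. x k i"] by simp
qed

section \<open>Cylinders given by finitely many bits, and bit flips\<close>

definition agree :: "(nat \<times> nat) set \<Rightarrow> (nat \<Rightarrow> cantor) \<Rightarrow> (nat \<Rightarrow> cantor) \<Rightarrow> bool" where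
  "agree F x y \<longleftrightarrow> (\<forall>(m, p)\<in>F. x m p = y m p)"

lemma agree_mono: "agree G x y \<Longrightarrow> F \<subseteq> G \<Longrightarrow> agree F x y"
  by (auto simp: agree_def)

lemma open_agree:
  assumes "open U" "x \<in> U"
  shows "\<exists>F. finite F \<and> (\<forall>y. agree F y x \<longrightarrow> y \<in> U)"
proof -
  obtain I X where I: "finite I" "\<And>m. open (X m)" "\<And>m. x m \<in> X m"
    "\<And>y. (\<forall>m\<in>I. y m \<in> X m) \<Longrightarrow> y \<in> U"
    using open_fun_finite[OF assms] by metis
  obtain J where J: "\<And>m. finite (J m)" "\<And>m z. (\<forall>p\<in>J m. z p = x m p) \<Longrightarrow> z \<in> X m"
    using open_fun_discrete_finite[OF I(2,3)] by metis
  show ?thesis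
  proof (intro exI conjI allI impI)
    show "finite (Sigma I J)" using I(1) J(1) by auto
    fix y assume "agree (Sigma I J) y x"
    then show "y \<in> U" by (intro I(4) ballI J(2)) (auto simp: agree_def)
  qed
qed

lemma open_agree_pair:
  assumes "open U" "(v, w) \<in> U"
  shows "\<exists>F. finite F \<and> (\<forall>x y. agree F x v \<longrightarrow> agree F y w \<longrightarrow> (x, y) \<in> U)"
proof -
  obtain V W where VW: "open V" "open W" "(v, w) \<in> V \<times> W" "V \<times> W \<subseteq> U"
    using open_prod_elim[OF assms] by metis
  obtain F where F: "finite F" "\<forall>y. agree F y v \<longrightarrow> y \<in> V"
    using open_agree VW(1,3) by blast
  obtain G where G: "finite G" "\<forall>y. agree G y w \<longrightarrow> y \<in> W"
    using open_agree VW(2,3) by blast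
  show ?thesis
    using F G VW(4) agree_mono[of "F \<union> G" _ _ F] agree_mono[of "F \<union> G" _ _ G]
    by (intro exI[of _ "F \<union> G"]) blast
qed

text \<open>Addition modulo 2 of the indicator of \<open>S\<close>: a homeomorphism which, for
  finite \<open>S\<close>, moves points only within their \<open>E0_omega\<close> class.\<close>

definition flip :: "(nat \<times> nat) set \<Rightarrow> (nat \<Rightarrow> cantor) \<Rightarrow> nat \<Rightarrow> cantor" where
  "flip S x = (\<lambda>m p. x m p \<noteq> ((m, p) \<in> S))"

lemma flip_flip: "flip S (flip S x) = x"
  by (auto simp: flip_def)

lemma map_prod_flip_flip: "map_prod (flip S) (flip T) (map_prod (flip S) (flip T) z) = z"
  by (cases z) (simp add: flip_flip)

lemma continuous_on_flip: "continuous_on UNIV (flip S)"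
  unfolding flip_def
  by (intro continuous_on_coordinatewise_then_product continuous_on_bool_coordinate)

lemma continuous_on_map_prod_flip: "continuous_on UNIV (map_prod (flip S) (flip T))"
  unfolding map_prod_def case_prod_beta
  by (intro continuous_on_Pair continuous_on_compose2[OF continuous_on_flip] continuous_intros) auto

text \<open>Flip exactly the bits in \<open>G\<close> where \<open>x\<close> differs from
  \<open>v\<close>; the bits of \<open>F\<close> outside \<open>G\<close> already agree.\<close>

lemma flip_onto:
  assumes "F \<subseteq> G \<union> H" "agree H x v"
  obtains S where "S \<subseteq> G" "agree F (flip S x) v"
  using assms by (intro that[of "{(m, p) \<in> G. x m p \<noteq> v m p}"]) (auto simp: flip_def agree_def)

lemma E0_iff: "(x, y) \<in> E0 \<longleftrightarrow> finite {i. x i \<noteq> y i}"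
  by (simp add: E0_def cofinite_eq_sequentially[symmetric] eventually_cofinite)

lemma flip_E0_omega:
  assumes "finite S"
  shows "(x, flip S x) \<in> E0_omega"
proof -
  have "{p. (m, p) \<in> S} \<subseteq> snd ` S" for m by force
  with assms show ?thesis
    by (auto simp: E0_omega_def E0_iff flip_def intro: finite_subset)
qed

text \<open>A topological zero-one law. \<open>V\<close> contains a cylinder on a finite set
  \<open>F\<close> of positions, and every pair is carried into it by flips within \<open>F\<close>.
  Invariance then covers the complement of \<open>A\<close> by finitely many homeomorphic copies of
  \<open>V - A\<close>.\<close>

lemma comeager_flip_invariant:
  assumes inv: "\<And>S T x y. finite S \<Longrightarrow> finite T \<Longrightarrow> (x, y) \<in> A \<Longrightarrow> (flip S x, flip T y) \<in> A"
    and "open V" "V \<noteq> {}" "meager (V - A)"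
  shows "meager (- A)"
proof -
  obtain v w where "(v, w) \<in> V" using assms(3) by auto
  then obtain F where F: "finite F" "\<And>x y. agree F x v \<Longrightarrow> agree F y w \<Longrightarrow> (x, y) \<in> V"
    using open_agree_pair[OF assms(2)] by metis
  have "meager (\<Union>(S, T)\<in>Pow F \<times> Pow F. map_prod (flip S) (flip T) -` (V - A))"
    using F(1) assms(4)
    by (intro meager_UN countable_finite)
      (auto intro!: meager_vimage_involution continuous_on_map_prod_flip map_prod_flip_flip)
  then show ?thesis
  proof (rule meager_subset, intro subsetI)
    fix z assume "z \<in> - A"
    then obtain x y where xy: "z = (x, y)" "(x, y) \<notin> A" by (cases z) auto
    obtain S where S: "S \<subseteq> F" "agree F (flip S x) v"
      using flip_onto[of F F "{}" x v] by (auto simp: agree_def)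
    obtain T where T: "T \<subseteq> F" "agree F (flip T y) w"
      using flip_onto[of F F "{}" y w] by (auto simp: agree_def)
    have "(flip S x, flip T y) \<notin> A"
      using inv[of S T "flip S x" "flip T y"] xy(2) S(1) T(1) F(1)
      by (auto simp: flip_flip intro: finite_subset)
    with F(2) S T have "z \<in> map_prod (flip S) (flip T) -` (V - A)" by (simp add: xy(1))
    with S(1) T(1) show "z \<in> (\<Union>(S, T)\<in>Pow F \<times> Pow F. map_prod (flip S) (flip T) -` (V - A))"
      by blast
  qed
qed

text \<open>Saturate the sets \<open>N j\<close>, \<open>j \<le> i\<close>, under flips within
  \<open>G\<close>. The result \<open>M\<close> is still nowhere dense, so some cylinder on a finite
  \<open>F\<close> misses it. Positions in \<open>G\<close> may be dropped from \<open>F\<close>,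
  because flips within \<open>G\<close> restore agreement there without affecting membership in
  \<open>M\<close>.\<close>

lemma nowhere_dense_avoid:
  fixes N :: "nat \<Rightarrow> ((nat \<Rightarrow> cantor) \<times> (nat \<Rightarrow> cantor)) set"
  assumes "\<And>j. nowhere_dense (N j)" "finite G"
  shows "\<exists>F v w. finite F \<and> F \<inter> G = {} \<and>
    (\<forall>x y. agree F x v \<longrightarrow> agree F y w \<longrightarrow> (\<forall>j\<le>i. (x, y) \<notin> N j))"
proof -
  define M where "M = (\<Union>(S, T, j)\<in>Pow G \<times> Pow G \<times> {..i}. map_prod (flip S) (flip T) -` N j)"
  have "nowhere_dense M" unfolding M_def
    using assms
    by (intro nowhere_dense_UN_finite)
      (auto intro!: nowhere_dense_vimage_involution continuous_on_map_prod_flip map_prod_flip_flip)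
  then have "closure M \<noteq> UNIV" by (auto simp: nowhere_dense_def)
  then obtain v w where "(v, w) \<in> - closure M" by auto
  moreover have "open (- closure M)" by auto
  ultimately obtain F where F: "finite F"
    "\<And>x y. agree F x v \<Longrightarrow> agree F y w \<Longrightarrow> (x, y) \<in> - closure M"
    using open_agree_pair by metis
  have "(x, y) \<notin> N j" if *: "agree (F - G) x v" "agree (F - G) y w" "j \<le> i" for x y j
  proof
    assume "(x, y) \<in> N j"
    obtain S where S: "S \<subseteq> G" "agree F (flip S x) v"
      using flip_onto[of F G "F - G" x v] *(1) by auto
    obtain T where T: "T \<subseteq> G" "agree F (flip T y) w"
      using flip_onto[of F G "F - G" y w] *(2) by auto
    have "(flip S x, flip T y) \<in> M"
      unfolding M_def using S(1) T(1) *(3) \<open>(x, y) \<in> N j\<close>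
      by (intro UN_I[of "(S, T, j)"]) (auto simp: flip_flip)
    with F(2)[OF S(2) T(2)] show False using closure_subset by blast
  qed
  with F(1) show ?thesis
    by (intro exI[of _ "F - G"] exI[of _ v] exI[of _ w]) auto
qed

text \<open>The avoidance step is repeated along an enumeration of all pairs \<open>(k, i)\<close>.
  Avoiding \<open>N k j\<close> only for \<open>j \<le> i\<close> is enough: a pair matching the
  patterns for infinitely many \<open>i\<close> avoids every \<open>N k j\<close>.\<close>

lemma nowhere_dense_disjoint_avoid:
  fixes N :: "nat \<Rightarrow> nat \<Rightarrow> ((nat \<Rightarrow> cantor) \<times> (nat \<Rightarrow> cantor)) set"
  assumes "\<And>k j. nowhere_dense (N k j)"
  shows "\<exists>F v w. (\<forall>k i. finite (F k i)) \<and>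
    (\<forall>k i k' i' q. q \<in> F k i \<longrightarrow> q \<in> F k' i' \<longrightarrow> k = k' \<and> i = i') \<and>
    (\<forall>k i j x y. agree (F k i) x (v k i) \<longrightarrow> agree (F k i) y (w k i) \<longrightarrow> j \<le> i \<longrightarrow> (x, y) \<notin> N k j)"
proof -
  define good where "good t = (\<lambda>(G, F, v, w). finite G \<and> finite F \<and> F \<inter> G = {} \<and>
    (\<forall>x y. agree F x v \<longrightarrow> agree F y w \<longrightarrow>
      (\<forall>j\<le>snd (prod_decode t). (x, y) \<notin> N (fst (prod_decode t)) j)))" for t
  have ex: "\<exists>F v w. good t (G, F, v, w)" if "finite G" for t G
    using nowhere_dense_avoid[OF assms that] that unfolding good_def by simp
  \<comment> \<open>\<open>G\<close> collects the positions used before stage \<open>t\<close>, which codes the pair \<open>(k, i)\<close>.\<close>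
  have "\<exists>s. \<forall>t. good t (s t) \<and> fst (s (Suc t)) = fst (s t) \<union> fst (snd (s t))"
  proof (rule dependent_nat_choice)
    show "\<exists>s. good 0 s" using ex[of "{}"] by blast
    fix s t assume s: "good t s"
    then have "finite (fst s \<union> fst (snd s))" by (auto simp: good_def)
    from ex[OF this, of "Suc t"]
    show "\<exists>s'. good (Suc t) s' \<and> fst s' = fst s \<union> fst (snd s)" by auto
  qed
  then obtain s where s: "\<And>t. good t (s t)"
    "\<And>t. fst (s (Suc t)) = fst (s t) \<union> fst (snd (s t))" by blast
  define G F v w where defs: "G t = fst (s t)" "F t = fst (snd (s t))"
    "v t = fst (snd (snd (s t)))" "w t = snd (snd (snd (s t)))" for t
  have good: "finite (F t)" "F t \<inter> G t = {}"
    "\<And>x y j. agree (F t) x (v t) \<Longrightarrow> agree (F t) y (w t) \<Longrightarrow> j \<le> snd (prod_decode t) \<Longrightarrow>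
      (x, y) \<notin> N (fst (prod_decode t)) j" for t
    using s(1)[of t] by (auto simp: good_def defs split: prod.splits)
  have GF: "G (Suc t) = G t \<union> F t" for t using s(2) by (simp add: defs)
  have "F t \<subseteq> G t'" if "t < t'" for t t'
    using that by (induction t') (auto simp: GF less_Suc_eq)
  then have disj: "q \<in> F t \<Longrightarrow> q \<in> F t' \<Longrightarrow> t = t'" for q t t'
    using good(2) by (metis disjoint_iff nat_neq_iff subsetD)
  let ?e = "\<lambda>k i. prod_encode (k, i)"
  have "k = k' \<and> i = i'" if "q \<in> F (?e k i)" "q \<in> F (?e k' i')" for k i k' i' q
    using disj[OF that] by simp
  moreover have "(x, y) \<notin> N k j"
    if "agree (F (?e k i)) x (v (?e k i))" "agree (F (?e k i)) y (w (?e k i))" "j \<le> i" for k i j x y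
    using good(3)[OF that(1,2)] that(3) by simp
  ultimately show ?thesis using good(1)
    by (intro exI[of _ "\<lambda>k i. F (?e k i)"] exI[of _ "\<lambda>k i. v (?e k i)"]
        exI[of _ "\<lambda>k i. w (?e k i)"] conjI allI impI) blast+
qed

section \<open>Splicing two sequences at a coordinate\<close>

definition splice :: "nat \<Rightarrow> (nat \<Rightarrow> 'a) \<Rightarrow> (nat \<Rightarrow> 'a) \<Rightarrow> nat \<Rightarrow> 'a" where
  "splice k x y = (\<lambda>m. if m < k then x m else y m)"

lemma splice_E0_omega:
  assumes "\<And>m. m < k \<Longrightarrow> (x m, x' m) \<in> E0" "\<And>m. k \<le> m \<Longrightarrow> (y m, y' m) \<in> E0"
  shows "(splice k x y, splice k x' y') \<in> E0_omega"
  using assms by (auto simp: E0_omega_def splice_def)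

lemma continuous_on_splice:
  "continuous_on UNIV (\<lambda>(x, y). (x :: nat \<Rightarrow> 'a::topological_space, splice k x y))"
proof -
  have "continuous_on UNIV (\<lambda>z :: (nat \<Rightarrow> 'a) \<times> (nat \<Rightarrow> 'a). if m < k then fst z m else snd z m)" for m
    by (cases "m < k")
      (simp_all add: continuous_on_product_then_coordinatewise continuous_on_fst continuous_on_snd)
  then show ?thesis
    unfolding splice_def case_prod_beta
    by (intro continuous_on_Pair continuous_on_coordinatewise_then_product continuous_intros)
qed

section \<open>The dichotomy\<close>

lemma E0_omega_reducible:
  assumes "equiv UNIV E" "E0_omega \<subseteq> E"
    and meager: "\<And>k. meager {(x, y). (x, splice k x y) \<in> E}"
  shows "E0_omega \<le>\<^sub>B E"
proof -
  have sym: "(x, y) \<in> E \<Longrightarrow> (y, x) \<in> E"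
    and trans: "(x, y) \<in> E \<Longrightarrow> (y, z) \<in> E \<Longrightarrow> (x, z) \<in> E" for x y z
    using assms(1) by (auto elim!: equivE dest: symD transD)
  have "\<exists>N. (\<forall>j::nat. nowhere_dense (N j)) \<and> {(x, y). (x, splice k x y) \<in> E} = (\<Union>j. N j)" for k
    using meager[of k] by (simp add: meager_def)
  then obtain N where N: "\<And>k j::nat. nowhere_dense (N k j)"
    "\<And>k. {(x, y). (x, splice k x y) \<in> E} = (\<Union>j. N k j)" by metis
  obtain F v w where fin: "\<And>k i. finite (F k i)"
    and disj: "\<And>k i k' i' q. q \<in> F k i \<Longrightarrow> q \<in> F k' i' \<Longrightarrow> k = k' \<and> i = i'"
    and avoid: "\<And>k i j x y. agree (F k i) x (v k i) \<Longrightarrow> agree (F k i) y (w k i) \<Longrightarrow> j \<le> i \<Longrightarrow> (x, y) \<notin> N k j"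
    using nowhere_dense_disjoint_avoid[of N, OF N(1)] by metis
  \<comment> \<open>By disjointness at most one pair \<open>(k, i)\<close> matters for each bit \<open>(m, p)\<close>, and it depends only on
    the coordinates of \<open>x\<close> up to \<open>m\<close>.\<close>
  define f where "f x m p \<longleftrightarrow> (\<exists>k i. (m, p) \<in> F k i \<and>
    (if m < k \<or> \<not> x k i then v k i m p else w k i m p))" for x m p
  have f_eq: "f x m p = (if m < k \<or> \<not> x k i then v k i m p else w k i m p)"
    if "(m, p) \<in> F k i" for x m p k i
    using that disj[OF that] unfolding f_def by metis
  have f_cong: "f x m p = f y m p"
    if "\<And>k i. (m, p) \<in> F k i \<Longrightarrow> k \<le> m \<Longrightarrow> x k i = y k i" for x y m p
    using that unfolding f_def by (metis not_less)
  have "continuous_on UNIV f"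
  proof (intro continuous_on_coordinatewise_then_product)
    fix m p
    show "continuous_on UNIV (\<lambda>x. f x m p)"
    proof (cases "\<exists>k i. (m, p) \<in> F k i")
      case True
      then obtain k i where "(m, p) \<in> F k i" by auto
      then show ?thesis using continuous_on_bool_coordinate
          [of "\<lambda>b. if m < k \<or> \<not> b then v k i m p else w k i m p" k i]
        by (simp add: f_eq)
    next
      case False
      then have "(\<lambda>x. f x m p) = (\<lambda>x. False)" by (auto simp: f_def)
      then show ?thesis by (simp only: continuous_on_const)
    qed
  qed
  then have borel: "f \<in> borel_measurable borel" by (rule borel_measurable_continuous_onI)
  have f_E0: "(f x m, f y m) \<in> E0" if "\<And>k. k \<le> m \<Longrightarrow> (x k, y k) \<in> E0" for x y m
  proof -
    \<comment> \<open>\<open>D\<close> lists the input bits in coordinates up to \<open>m\<close> at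
      which \<open>x\<close> and \<open>y\<close> differ. It is finite, and the input bit
      \<open>(k, i)\<close> controls only output bits in the finite set
      \<open>F k i\<close>.\<close>
    define D where "D = (SIGMA k:{..m}. {i. x k i \<noteq> y k i})"
    have "{p. f x m p \<noteq> f y m p} \<subseteq> (\<Union>(k, i)\<in>D. snd ` F k i)"
    proof
      fix p assume "p \<in> {p. f x m p \<noteq> f y m p}"
      then obtain k i where "(m, p) \<in> F k i" "k \<le> m" "x k i \<noteq> y k i"
        using f_cong[of m p x y] by blast
      then show "p \<in> (\<Union>(k, i)\<in>D. snd ` F k i)" by (force simp: D_def)
    qed
    moreover have "finite (\<Union>(k, i)\<in>D. snd ` F k i)"
    proof (rule finite_UN_I)
      show "finite D" using that unfolding D_def E0_iff by (intro finite_SigmaI) auto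
    qed (use fin in auto)
    ultimately show ?thesis unfolding E0_iff by (rule finite_subset)
  qed
  \<comment> \<open>One direction of disagreement suffices; the other is obtained by exchanging
    \<open>x\<close> and \<open>y\<close>. Here \<open>f x\<close> carries \<open>v k i\<close> on
    all of \<open>F k i\<close> for infinitely many \<open>i\<close>, while \<open>f y\<close>
    carries \<open>w k i\<close> there only from coordinate \<open>k\<close> on.\<close>
  have separate: "(f x, f y) \<notin> E"
    if E0: "\<And>m. m < k \<Longrightarrow> (x m, y m) \<in> E0" and inf: "infinite {i. \<not> x k i \<and> y k i}" for x y k
  proof
    assume fE: "(f x, f y) \<in> E"
    \<comment> \<open>\<open>A\<^sub>k\<close> ignores the second argument below \<open>k\<close>, so \<open>f y\<close> may be replaced there by the pattern.\<close>
    define z where "z m p \<longleftrightarrow> (if m < k then \<exists>i. (m, p) \<in> F k i \<and> w k i m p else f y m p)" for m p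
    have "(f x, z) \<notin> N k j" for j
    proof -
      obtain i where i: "j \<le> i" "\<not> x k i" "y k i"
        using inf by (auto simp: infinite_nat_iff_unbounded_le)
      have "agree (F k i) (f x) (v k i)" using i by (auto simp: agree_def f_eq)
      moreover have "agree (F k i) z (w k i)"
        unfolding agree_def
      proof (clarify)
        fix m p assume mp: "(m, p) \<in> F k i"
        then have "(\<exists>i'. (m, p) \<in> F k i' \<and> w k i' m p) = w k i m p" using disj by metis
        with mp i(3) show "z m p = w k i m p" by (simp add: z_def f_eq)
      qed
      ultimately show ?thesis using avoid i(1) by blast
    qed
    then have "(f x, splice k (f x) z) \<notin> E" using N(2)[of k] by blast
    moreover have "splice k (f x) z = splice k (f x) (f y)" by (auto simp: splice_def z_def fun_eq_iff)
    \<comment> \<open>Below \<open>k\<close> the values \<open>f x\<close> and \<open>f y\<close>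
      are \<open>E0\<close>-related, so \<open>f y\<close> is \<open>E\<close>-related to the
      splice. With \<open>fE\<close> so is \<open>f x\<close>, which contradicts the avoidance just
      shown.\<close>
    moreover have "(f y, splice k (f x) (f y)) \<in> E0_omega"
    proof -
      have "(f y m, f x m) \<in> E0" if "m < k" for m
        using that E0 by (intro f_E0) (auto simp: E0_iff eq_commute)
      then have "(splice k (f y) (f y), splice k (f x) (f y)) \<in> E0_omega"
        by (intro splice_E0_omega) (auto simp: E0_iff)
      then show ?thesis by (simp add: splice_def)
    qed
    ultimately show False using trans[OF fE] assms(2) by (metis subsetD)
  qed
  have "(x, y) \<in> E0_omega \<longleftrightarrow> (f x, f y) \<in> E" for x y
  proof
    assume "(x, y) \<in> E0_omega"
    then have "(f x, f y) \<in> E0_omega" using f_E0 by (simp add: E0_omega_def)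
    then show "(f x, f y) \<in> E" using assms(2) by blast
  next
    assume fE: "(f x, f y) \<in> E"
    show "(x, y) \<in> E0_omega"
    proof (rule ccontr)
      assume "(x, y) \<notin> E0_omega"
      then have "\<exists>k. (x k, y k) \<notin> E0" by (simp add: E0_omega_def)
      then obtain k where k: "(x k, y k) \<notin> E0" "\<And>m. m < k \<Longrightarrow> (x m, y m) \<in> E0"
        using exists_least_iff[of "\<lambda>k. (x k, y k) \<notin> E0"] by blast
      have "{i. x k i \<noteq> y k i} = {i. \<not> x k i \<and> y k i} \<union> {i. \<not> y k i \<and> x k i}" by auto
      with k(1) have "infinite {i. \<not> x k i \<and> y k i} \<or> infinite {i. \<not> y k i \<and> x k i}"
        by (simp add: E0_iff)
      then show False
      proof
        assume "infinite {i. \<not> x k i \<and> y k i}"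
        with separate[of k x y] k(2) fE show False by simp
      next
        assume "infinite {i. \<not> y k i \<and> x k i}"
        moreover have "(y m, x m) \<in> E0" if "m < k" for m
          using k(2)[OF that] by (simp add: E0_iff eq_commute)
        ultimately have "(f y, f x) \<notin> E" by (intro separate[of k y x])
        with sym[OF fE] show False by simp
      qed
    qed
  qed
  with borel show ?thesis unfolding borel_reducible_def by blast
qed

lemma extends_E0_fin_on_comeager:
  assumes "equiv UNIV E" "E0_omega \<subseteq> E"
    and comeager: "meager (- {(x, y). (x, splice k x y) \<in> E})"
  shows "\<exists>C. comeager C \<and>
    (\<forall>x\<in>C. \<forall>y\<in>C. (restrict x {..<k}, restrict y {..<k}) \<in> E0_fin k \<longrightarrow> (x, y) \<in> E)"
proof -
  have sym: "(x, y) \<in> E \<Longrightarrow> (y, x) \<in> E"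
    and trans: "(x, y) \<in> E \<Longrightarrow> (y, z) \<in> E \<Longrightarrow> (x, z) \<in> E" for x y z
    using assms(1) by (auto elim!: equivE dest: symD transD)
  define C where "C = {x. meager {y. (x, splice k x y) \<notin> E}}"
  have "comeager C"
    using Kuratowski_Ulam[OF comeager] by (simp add: comeager_def C_def Collect_neg_eq)
  moreover have "(x, y) \<in> E"
    if "x \<in> C" "y \<in> C" "(restrict x {..<k}, restrict y {..<k}) \<in> E0_fin k" for x y
  proof -
    have "meager ({z. (x, splice k x z) \<notin> E} \<union> {z. (y, splice k y z) \<notin> E})"
      using that(1,2) by (intro meager_Un) (auto simp: C_def)
    \<comment> \<open>The two exceptional sets cannot cover the space by Baire category. Any
      \<open>z\<close> outside them gives splices with the same tail, which differ only below
      \<open>k\<close>.\<close>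
    then have "{z. (x, splice k x z) \<notin> E} \<union> {z. (y, splice k y z) \<notin> E} \<noteq> UNIV"
      using not_meager_UNIV_cantor_sequence by metis
    then obtain z where z: "(x, splice k x z) \<in> E" "(y, splice k y z) \<in> E" by blast
    have "(splice k x z, splice k y z) \<in> E0_omega"
      using that(3) by (intro splice_E0_omega) (auto simp: E0_fin_def E0_iff)
    with z assms(2) show ?thesis using sym trans by blast
  qed
  ultimately show ?thesis by blast
qed

theorem theorem3p2:
  fixes E :: "((nat \<Rightarrow> cantor) \<times> (nat \<Rightarrow> cantor)) set"
  assumes "equiv UNIV E"
    and "analytic_set E"
    and "E0_omega \<subseteq> E"
  shows "E0_omega \<le>\<^sub>B E \<or>
    (\<exists>(k::nat) C. comeager C \<and>
      (\<forall>x\<in>C. \<forall>y\<in>C. (restrict x {..<k}, restrict y {..<k}) \<in> E0_fin k \<longrightarrow> (x, y) \<in> E))"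
proof (cases "\<forall>k. meager {(x, y). (x, splice k x y) \<in> E}")
  case True
  with assms(1,3) show ?thesis by (intro disjI1 E0_omega_reducible) auto
next
  case False
  then obtain k where k: "\<not> meager {(x, y). (x, splice k x y) \<in> E}" by auto
  define A where "A = {(x, y). (x, splice k x y) \<in> E}"
  have A: "A = (\<lambda>(x, y). (x, splice k x y)) -` E" by (auto simp: A_def)
  have "Hausdorff_space (euclidean :: ((nat \<Rightarrow> cantor) \<times> (nat \<Rightarrow> cantor)) topology)"
    unfolding prod_topology_euclidean[symmetric] Hausdorff_space_prod_topology
    by (intro disjI2 conjI Hausdorff_fun Hausdorff_bool)
  then obtain V where V: "open V" "V \<noteq> {}" "meager (V - A)"
    by (rule vimage_analytic_comeager_in_open[OF _ continuous_on_splice assms(2), of k])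
      (use k in \<open>simp_all add: A[symmetric] flip: A_def\<close>)
  \<comment> \<open>Finite flips change \<open>x\<close>, \<open>y\<close> and hence their splice
    only within \<open>E0_omega\<close> classes, so \<open>E\<close> is kept by
    transitivity.\<close>
  have "(flip S x, flip T y) \<in> A" if "finite S" "finite T" "(x, y) \<in> A" for S T x y
  proof -
    have "(flip S x, x) \<in> E0_omega" "(x, flip S x) \<in> E0_omega" "(y, flip T y) \<in> E0_omega"
      using flip_E0_omega[OF that(1), of "flip S x"] flip_E0_omega[OF that(1), of x]
        flip_E0_omega[OF that(2), of y] by (simp_all add: flip_flip)
    moreover from this have "(splice k x y, splice k (flip S x) (flip T y)) \<in> E0_omega"
      by (intro splice_E0_omega) (auto simp: E0_omega_def)
    ultimately show ?thesis
      using that(3) assms(1,3) unfolding A_def by (auto elim!: equivE) (meson subsetD transD)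
  qed
  then have "meager (- A)" using V by (rule comeager_flip_invariant)
  with assms(1,3) show ?thesis
    unfolding A_def by (intro disjI2 exI[of _ k] extends_E0_fin_on_comeager)
qed

end
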